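(* Let $p,q\ge1$ and let $Q$ be an acyclic quiver of type $\widetilde{\mathbb{A}}_{p,q}$. Let $m=\operatorname{lcm}(p,q)$. Then for all $i\in Q_0$ and all $t\ge m$, $$f_i(t+m)=C(p,q)\,f_i(t)-f_i(t-m).$$
   Context: An acyclic quiver of type $\widetilde{\mathbb{A}}_{p,q}$ is a quiver with $n=p+q$ vertices whose underlying graph is a cycle of length $n$ (two parallel edges if $n=2$), with $p$ arrows pointing in one direction around the cycle and $q$ arrows in the other. Label its vertices $1,\dots,n$ so that $i>j$ whenever there is an arrow $i\to j$. Define $f_i(t)$ ($i\in Q_0$, $t\in\mathbb{Z}_{\ge 0}$) recursively by $f_i(0)=1$ and $$f_i(t+1)=\frac{1+\prod_{j\to i}f_j(t)\ \prod_{j\leftarrow i}f_j(t+1)}{f_i(t)},$$ the products running over all arrows ending at $i$, respectively starting at $i$, with multiplicity. Definition of $C(p,q)$ (it depends on $Q$, not only on $p,q$). Put $k=(p+q)/\gcd(p,q)$. The quiver $Q$ is the quiver of a triangulation $T$ of the annulus with $p$ marked points on one boundary component and $q$ on the other, all arcs of $T$ joining the two boundary components. Let $L$ be the closed simple curve given by the equator of the annulus, and $X_L$ the associated Laurent polynomial in the initial cluster variables $x_1,\dots,x_n$ (its lambda length $2\cosh(\mathrm{length}(L)/2)$ expressed in the lambda lengths $x_i$ of the arcs of $T$, boundary segments having lambda length $1$). The $k$-bracelet $\mathrm{Brac}_k(L)$ is the $k$-fold concatenation of $L$ with itself; its Laurent polynomials satisfy $X_{\mathrm{Brac}_0(L)}=2$,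 $X_{\mathrm{Brac}_1(L)}=X_L$, $X_{\mathrm{Brac}_k(L)}=X_L X_{\mathrm{Brac}_{k-1}(L)}-X_{\mathrm{Brac}_{k-2}(L)}$. Then $C(p,q)=X_{\mathrm{Brac}_k(L)}|_{x_1=\cdots=x_n=1}$, a positive integer. Concretely: go once around the underlying cycle of $Q$ in a fixed direction, meeting arrows $e_1,\dots,e_n$ in this order; let $M_i=\begin{pmatrix}1&1\\0&1\end{pmatrix}$ if $e_i$ points in the chosen direction and $M_i=\begin{pmatrix}1&0\\1&1\end{pmatrix}$ otherwise. Then $X_L|_{x_i=1}=\operatorname{tr}(M_1M_2\cdots M_n)=:B_1$, and $C(p,q)=B_k$ where $B_0=2$ and $B_j=B_1B_{j-1}-B_{j-2}$ for $j\ge2$. *)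

theory Defs
  imports "HOL-Analysis.Determinants" "Graph_Theory.Digraph"
begin

text \<open>
  Quivers are directed multigraphs, i.e. values of type \<open>pre_digraph\<close>; an arrow
  \<open>a : i \<rightarrow> j\<close> has \<open>tail Q a = i\<close> and \<open>head Q a = j\<close>.

  \<open>cycle_traversal Q vs es\<close> says that the underlying graph of \<open>Q\<close> is a cycle, visited once in the
  cyclic vertex order \<open>vs\<close>, where the arrow \<open>es ! i\<close> joins \<open>vs ! i\<close> to the next vertex, in either
  orientation. Two vertices give two parallel edges.
\<close>

definition cycle_traversal :: "('a, 'b) pre_digraph \<Rightarrow> 'a list \<Rightarrow> 'b list \<Rightarrow> bool" where
  "cycle_traversal Q vs es \<longleftrightarrow>
     distinct vs \<and> set vs = verts Q \<and> distinct es \<and> set es = arcs Q \<and> length es = length vs \<and>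
     (\<forall>i<length es. {tail Q (es ! i), head Q (es ! i)} = {vs ! i, vs ! (Suc i mod length vs)})"

definition forward_arrow :: "('a, 'b) pre_digraph \<Rightarrow> 'a list \<Rightarrow> 'b list \<Rightarrow> nat \<Rightarrow> bool" where
  "forward_arrow Q vs es i \<longleftrightarrow>
     tail Q (es ! i) = vs ! i \<and> head Q (es ! i) = vs ! (Suc i mod length vs)"

definition affine_A_quiver :: "nat \<Rightarrow> nat \<Rightarrow> ('a, 'b) pre_digraph \<Rightarrow> bool" where
  "affine_A_quiver p q Q \<longleftrightarrow>
     (\<exists>vs es. cycle_traversal Q vs es \<and>
        card {i. i < length es \<and> forward_arrow Q vs es i} = p \<and>
        card {i. i < length es \<and> \<not> forward_arrow Q vs es i} = q)"

definition step_matrix :: "bool \<Rightarrow> int^2^2" where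
  "step_matrix fwd = (if fwd then vector [vector [1, 1], vector [0, 1]]
                      else vector [vector [1, 0], vector [1, 1]])"

text \<open>
  The Laurent polynomial (lambda length) of the equator of the annulus, evaluated at initial cluster
  variables equal to 1, is the trace of the product of the step matrices in the order of a
  traversal. The trace does not depend on the traversal: changing the starting point conjugates the
  product, and reversing the direction transposes it.
\<close>

definition equator_value :: "('a, 'b) pre_digraph \<Rightarrow> 'a list \<Rightarrow> 'b list \<Rightarrow> int" where
  "equator_value Q vs es =
     trace (foldr (**) (map (\<lambda>i. step_matrix (forward_arrow Q vs es i)) [0..<length es]) (mat 1))"

fun bracelet :: "int \<Rightarrow> nat \<Rightarrow> int" where
  "bracelet x 0 = 2"
| "bracelet x (Suc 0) = x"
| "bracelet x (Suc (Suc k)) = x * bracelet x (Suc k) - bracelet x k"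

definition C_const :: "nat \<Rightarrow> nat \<Rightarrow> ('a, 'b) pre_digraph \<Rightarrow> 'a list \<Rightarrow> 'b list \<Rightarrow> int" where
  "C_const p q Q vs es = bracelet (equator_value Q vs es) ((p + q) div gcd p q)"

end

theory Submission
  imports Defs
begin

text \<open>
  Cut the annulus open: its universal cover is a strip, the marked points of one boundary line are
  numbered by \<open>a\<close>, those of the other by \<open>b\<close>, and the arcs of the lifted triangulation form a
  sequence \<open>(b\<^sub>j, a\<^sub>j)\<close> in which every step raises one of the two ends by one: a forward arrow raises
  \<open>a\<close>, a backward arrow raises \<open>b\<close>. Give the marked points integral vectors \<open>u\<^sub>a\<close> and \<open>w\<^sub>b\<close> such
  that the lambda length of the arc from \<open>b\<close> to \<open>a\<close> is the determinant \<open>\<lambda>(b, a) = det(w\<^sub>b, u\<^sub>a)\<close>.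
  Boundary segments and arcs of the triangulation have lambda length one, so one step multiplies
  the matrix with columns \<open>w\<^sub>b, u\<^sub>a\<close> from the right by the step matrix of the arrow
  (\<open>frame_column\<close>).

  The Pluecker relation turns into
  \<open>\<lambda>(b, a + 1) \<lambda>(b + 1, a) = 1 + \<lambda>(b, a) \<lambda>(b + 1, a + 1)\<close>, and this is exactly the recursion for
  \<open>f\<close>: passing from time \<open>t\<close> to \<open>t + 1\<close> moves both ends of each arc by one, in opposite senses of
  the strip. Hence the value at the \<open>j\<close>-th vertex is \<open>f(t) = \<lambda>(b\<^sub>j + t, a\<^sub>j - t)\<close>
  (\<open>recursion_eq_lambda\<close>).

  Going once around the annulus multiplies both families of vectors by the same matrix \<open>M\<close>, the
  product of all step matrices: \<open>u\<^bsub>a+p\<^esub> = M u\<^sub>a\<close> and \<open>w\<^bsub>b+q\<^esub> = M w\<^sub>b\<close>. As \<open>det M = 1\<close>, the value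
  \<open>\<lambda>\<close> is invariant under \<open>(b, a) \<mapsto> (b + q, a + p)\<close>, so the change \<open>(b + m, a - m)\<close> caused by
  \<open>m = lcm p q\<close> time steps amounts to applying \<open>M\<close> to \<open>w\<close> exactly \<open>m/q + m/p = (p + q)/gcd p q\<close>
  times. By Cayley-Hamilton, \<open>\<lambda>\<close> obeys a two-term recurrence with coefficient \<open>tr M\<close> in the number
  of applications of \<open>M\<close>, and in steps of \<open>k\<close> such a recurrence has the \<open>k\<close>-th bracelet
  polynomial as its coefficient (\<open>bracelet_recurrence\<close>).

  The numbers \<open>p\<close> and \<open>q\<close> come from some traversal of the cycle and the matrices from a possibly
  different one; \<open>forward_count_unique\<close> shows that the two can only differ by exchanging
  \<open>p\<close> and \<open>q\<close>, under which the claim is symmetric.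
\<close>

section \<open>Counting steps of one kind\<close>

definition count_before :: "(nat \<Rightarrow> bool) \<Rightarrow> nat \<Rightarrow> nat" where
  "count_before P j = card {i. i < j \<and> P i}"

lemma count_before_0 [simp]: "count_before P 0 = 0"
  by (simp add: count_before_def)

lemma count_before_Suc [simp]:
  "count_before P (Suc j) = (if P j then Suc (count_before P j) else count_before P j)"
proof -
  have "{i. i < Suc j \<and> P i} =
      (if P j then insert j {i. i < j \<and> P i} else {i. i < j \<and> P i})"
    by (auto simp: less_Suc_eq)
  then show ?thesis
    by (simp add: count_before_def)
qed

lemma count_before_add_period:
  assumes "\<And>j. P (j + n) = P j"
  shows "count_before P (j + n) = count_before P j + count_before P n"
  by (induction j) (simp_all add: assms)

lemma count_before_add_multiple:
  assumes "\<And>j. P (j + n) = P j"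
  shows "count_before P (j + N * n) = count_before P j + N * count_before P n"
proof (induction N)
  case (Suc N)
  have "count_before P (j + Suc N * n) = count_before P ((j + N * n) + n)"
    by (simp add: algebra_simps)
  then show ?case
    using Suc count_before_add_period[of P n, OF assms] by simp
qed simp

lemma count_before_attained:
  assumes "x < count_before P j"
  shows "\<exists>i. P i \<and> count_before P i = x"
  using assms
proof (induction j)
  case (Suc j)
  then show ?case
    by (cases "x < count_before P j") (auto split: if_splits simp: less_Suc_eq)
qed simp

text \<open>
  A sequence that changes only at the steps satisfying \<open>P\<close> is a function of the number of such
  steps; this is what lets a boundary point own its vector, although many arcs end there.
\<close>

lemma factors_through_count_before:
  assumes "\<And>j. \<not> P j \<Longrightarrow> X (Suc j) = X j"
  obtains u where "\<And>j. u (count_before P j) = X j"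
proof -
  have le: "X i = X j" if "i \<le> j" "count_before P i = count_before P j" for i j
    using that
  proof (induction j rule: dec_induct)
    case (step j)
    have "count_before P i \<le> count_before P j"
      unfolding count_before_def using step.hyps by (intro card_mono) auto
    with step assms show ?case
      by (auto split: if_splits)
  qed simp
  have eq: "X i = X j" if "count_before P i = count_before P j" for i j
    using le that by (metis nat_le_linear)
  have "X (SOME i. count_before P i = count_before P j) = X j" for j
    by (rule eq, rule someI[of _ j]) simp
  then show thesis
    by (rule that[of "\<lambda>x. X (SOME i. count_before P i = x)"])
qed

section \<open>The vectors of the marked points\<close>

definition cross :: "int^2 \<Rightarrow> int^2 \<Rightarrow> int" where
  "cross x y = x $ 1 * y $ 2 - x $ 2 * y $ 1"

lemma cross_Pluecker:
  "cross w u * cross w' u' - cross w u' * cross w' u = cross w w' * cross u u'"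
  by (simp add: cross_def algebra_simps)

lemma cross_matrix_vector_mult: "cross (M *v x) (M *v y) = det M * cross x y"
  by (simp add: cross_def det_2 matrix_vector_mult_def sum_2 algebra_simps)

lemma cross_Cayley_Hamilton:
  "cross (M *v (M *v w)) u = trace M * cross (M *v w) u - det M * cross w u"
  by (simp add: cross_def det_2 trace_def matrix_vector_mult_def sum_2 algebra_simps)

primrec frame :: "(nat \<Rightarrow> bool) \<Rightarrow> nat \<Rightarrow> int^2^2" where
  "frame s 0 = mat 1"
| "frame s (Suc j) = frame s j ** step_matrix (s j)"

lemma frame_add_period:
  assumes "\<And>j. s (j + n) = s j"
  shows "frame s (j + n) = frame s n ** frame s j"
  by (induction j) (simp_all add: assms matrix_mul_assoc)

lemma frame_eq_foldr:
  "frame s j = foldr (**) (map (\<lambda>i. step_matrix (s i)) [0..<j]) (mat 1)"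
proof -
  have *: "foldr (**) Ms X = foldr (**) Ms (mat 1) ** X" for Ms and X :: "int^2^2"
    by (induction Ms) (simp_all add: matrix_mul_assoc)
  show ?thesis
  proof (induction j)
    case (Suc j)
    then show ?case
      using *[of "map (\<lambda>i. step_matrix (s i)) [0..<j]" "step_matrix (s j)"] by simp
  qed simp
qed

lemma det_frame: "det (frame s j) = 1"
proof (induction j)
  case (Suc j)
  have "det (step_matrix (s j)) = 1"
    by (simp add: step_matrix_def det_2)
  with Suc show ?case
    by (simp add: det_mul)
qed simp

lemma cross_frame_columns: "cross (column 1 (frame s j)) (column 2 (frame s j)) = 1"
  using det_frame[of s j] by (simp add: cross_def column_def det_2 algebra_simps)

lemma column_mult: "column k (A ** B) = A *v column k (B :: int^2^2)"
  by (simp add: vec_eq_iff column_def matrix_vector_mult_def matrix_matrix_mult_def)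

lemma frame_column:
  "column 1 (frame s (Suc j)) =
     (if s j then column 1 (frame s j) else column 1 (frame s j) + column 2 (frame s j))"
  "column 2 (frame s (Suc j)) =
     (if s j then column 1 (frame s j) + column 2 (frame s j) else column 2 (frame s j))"
  by (simp_all add: vec_eq_iff column_def matrix_matrix_mult_def sum_2 step_matrix_def)

lemma cross_self [simp]: "cross x x = 0"
  by (simp add: cross_def)

lemma cross_add_left: "cross (x + y) z = cross x z + cross y z"
  and cross_add_right: "cross x (y + z) = cross x y + cross x z"
  by (simp_all add: cross_def algebra_simps)

text \<open>
  The lambda lengths of all bridging arcs of the strip. The four properties are: arcs of the
  triangulation have length one, the Ptolemy relation, invariance under the deck transformation,
  and the Cayley-Hamilton recurrence for repeatedly winding one end around the annulus.
\<close>

lemma lambda_lengths_exist: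
  fixes s :: "nat \<Rightarrow> bool"
  defines "A \<equiv> count_before s" and "B \<equiv> count_before (\<lambda>j. \<not> s j)"
  assumes per: "\<And>j. s (j + n) = s j" and p: "A n \<ge> 1" and q: "B n \<ge> 1"
  obtains lam :: "nat \<Rightarrow> nat \<Rightarrow> int" where
    "\<And>j. lam (B j) (A j) = 1"
    "\<And>b a. lam b (Suc a) * lam (Suc b) a = 1 + lam b a * lam (Suc b) (Suc a)"
    "\<And>b a. lam (b + B n) (a + A n) = lam b a"
    "\<And>b a. lam (b + 2 * B n) a = trace (frame s n) * lam (b + B n) a - lam b a"
proof -
  let ?M = "frame s n"
  obtain u where u: "\<And>j. u (A j) = column 2 (frame s j)"
    unfolding A_def
    by (rule factors_through_count_before[of s "\<lambda>j. column 2 (frame s j)"])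
       (auto simp: frame_column(2) simp del: frame.simps)
  obtain w where w: "\<And>j. w (B j) = column 1 (frame s j)"
    unfolding B_def
    by (rule factors_through_count_before[of "\<lambda>j. \<not> s j" "\<lambda>j. column 1 (frame s j)"])
       (auto simp: frame_column(1) simp del: frame.simps)
  have A_hit: "\<exists>j. s j \<and> A j = x" for x
  proof (rule count_before_attained[of x s "Suc x * n", folded A_def])
    have "A (0 + Suc x * n) = Suc x * A n"
      unfolding A_def using count_before_add_multiple[of s n, OF per, of 0 "Suc x"] by simp
    also have "\<dots> > x" using mult_le_mono2[OF p, of "Suc x"] by simp
    finally show "x < A (Suc x * n)" by simp
  qed
  have B_hit: "\<exists>j. \<not> s j \<and> B j = x" for x
  proof (rule count_before_attained[of x "\<lambda>j. \<not> s j" "Suc x * n", folded B_def])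
    have "B (0 + Suc x * n) = Suc x * B n"
      unfolding B_def using count_before_add_multiple[of "\<lambda>j. \<not> s j" n 0 "Suc x"] per by simp
    also have "\<dots> > x" using mult_le_mono2[OF q, of "Suc x"] by simp
    finally show "x < B (Suc x * n)" by simp
  qed
  have u_seg: "cross (u (Suc a)) (u a) = 1" for a
  proof -
    obtain j where j: "s j" "A j = a" using A_hit by blast
    then have "A (Suc j) = Suc a" by (simp add: A_def)
    then have "u (Suc a) = column 1 (frame s j) + column 2 (frame s j)"
      using u[of "Suc j"] j(1) by (simp add: frame_column(2) del: frame.simps)
    moreover have "u a = column 2 (frame s j)" using u[of j] j(2) by simp
    ultimately show ?thesis
      using cross_frame_columns[of s j] by (simp add: cross_add_left)
  qed
  have w_seg: "cross (w b) (w (Suc b)) = 1" for b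
  proof -
    obtain j where j: "\<not> s j" "B j = b" using B_hit by blast
    then have "B (Suc j) = Suc b" by (simp add: B_def)
    then have "w (Suc b) = column 1 (frame s j) + column 2 (frame s j)"
      using w[of "Suc j"] j(1) by (simp add: frame_column(1) del: frame.simps)
    moreover have "w b = column 1 (frame s j)" using w[of j] j(2) by simp
    ultimately show ?thesis
      using cross_frame_columns[of s j] by (simp add: cross_add_right)
  qed
  have u_per: "u (a + A n) = ?M *v u a" for a
  proof -
    obtain j where "A j = a" using A_hit by blast
    moreover have "A (j + n) = A j + A n"
      unfolding A_def by (rule count_before_add_period[of s n, OF per])
    ultimately show ?thesis
      using u[of "j + n"] u[of j] by (simp add: frame_add_period[of s n, OF per] column_mult)
  qed
  have w_per: "w (b + B n) = ?M *v w b" for b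
  proof -
    obtain j where "B j = b" using B_hit by blast
    moreover have "B (j + n) = B j + B n"
      unfolding B_def by (rule count_before_add_period) (simp add: per)
    ultimately show ?thesis
      using w[of "j + n"] w[of j] by (simp add: frame_add_period[of s n, OF per] column_mult)
  qed
  show thesis
  proof (rule that[of "\<lambda>b a. cross (w b) (u a)"])
    show "cross (w (B j)) (u (A j)) = 1" for j
      by (simp add: u w cross_frame_columns)
    show "cross (w b) (u (Suc a)) * cross (w (Suc b)) (u a) =
        1 + cross (w b) (u a) * cross (w (Suc b)) (u (Suc a))" for b a
      using cross_Pluecker[of "w b" "u (Suc a)" "w (Suc b)" "u a"]
      by (simp add: u_seg w_seg)
    show "cross (w (b + B n)) (u (a + A n)) = cross (w b) (u a)" for b a
      by (simp add: u_per w_per cross_matrix_vector_mult det_frame)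
    show "cross (w (b + 2 * B n)) (u a) =
        trace ?M * cross (w (b + B n)) (u a) - cross (w b) (u a)" for b a
    proof -
      have "w (b + 2 * B n) = ?M *v (?M *v w b)"
        using w_per[of "b + B n"] w_per[of b] by (simp add: add.assoc mult_2)
      then show ?thesis
        by (simp add: w_per cross_Cayley_Hamilton det_frame)
    qed
  qed
qed

text \<open>
  If \<open>g\<close> is a combination of \<open>z\<^sup>j\<close> and \<open>z\<^sup>-\<^sup>j\<close> with \<open>x = z + 1/z\<close>, then the bracelet polynomial is
  \<open>z\<^sup>k + 1/z\<^sup>k\<close>. The centred form below goes through by induction on \<open>k\<close> without roots.
\<close>

lemma bracelet_recurrence:
  fixes g :: "nat \<Rightarrow> int"
  assumes g: "\<And>j. g (j + 2) = x * g (j + 1) - g j" and "k \<le> j"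
  shows "g (j + k) + g (j - k) = bracelet x k * g j"
  using \<open>k \<le> j\<close>
proof (induction k rule: induct_nat_012)
  case 1
  then show ?case using g[of "j - 1"] by simp
next
  case (ge2 k)
  have "j - Suc (Suc k) + 2 = j - k" "j - Suc (Suc k) + 1 = j - Suc k"
    using ge2.prems by simp_all
  then have "g (j - k) = x * g (j - Suc k) - g (j - Suc (Suc k))"
    using g[of "j - Suc (Suc k)"] by simp
  moreover have "g (j + Suc (Suc k)) = x * g (j + Suc k) - g (j + k)"
    using g[of "j + k"] by simp
  moreover have "g (j + k) + g (j - k) = bracelet x k * g j"
    using ge2 by simp
  moreover have "x * g (j + Suc k) + x * g (j - Suc k) = x * bracelet x (Suc k) * g j"
    using ge2 by (simp add: distrib_left[symmetric])
  ultimately show ?case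
    by (simp add: algebra_simps)
qed simp

section \<open>The recursion computes lambda lengths\<close>

text \<open>
  The two factors in the numerator are the lengths of the two sides of the quadrilateral around the
  arc \<open>j\<close> which are not boundary segments. The direction of an arrow decides both which end
  distinguishes the neighbour from the arc \<open>j\<close> and whether the neighbour is taken before or after
  its own mutation; the two effects combine so that either direction yields the same side.
  The rank makes the simultaneous recursion at time \<open>t + 1\<close> well-founded, and positivity is
  carried along in order to divide.
\<close>

lemma recursion_eq_lambda:
  fixes s :: "nat \<Rightarrow> bool" and F :: "nat \<Rightarrow> nat \<Rightarrow> rat" and lam :: "nat \<Rightarrow> nat \<Rightarrow> int"
    and rank :: "nat \<Rightarrow> nat"
  defines "A \<equiv> count_before s" and "B \<equiv> count_before (\<lambda>j. \<not> s j)"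
  assumes start: "\<And>j. lam (B j) (A j) = 1"
    and Ptolemy: "\<And>b a. lam b (Suc a) * lam (Suc b) a = 1 + lam b a * lam (Suc b) (Suc a)"
    and F0: "\<And>j. F j 0 = 1"
    and F_Suc: "\<And>j t. F (Suc j) (Suc t) =
        (1 + F j (if s j then t else Suc t) *
             F (Suc (Suc j)) (if s (Suc j) then Suc t else t)) / F (Suc j) t"
    and rank: "\<And>j. if s j then rank (Suc j) < rank j else rank j < rank (Suc j)"
    and "t \<le> A j"
  shows "F j t = of_int (lam (B j + t) (A j - t)) \<and> lam (B j + t) (A j - t) > 0"
  using \<open>t \<le> A j\<close>
proof (induction t arbitrary: j)
  case 0
  then show ?case by (simp add: F0 start)
next
  case (Suc t)
  note earlier = Suc.IH
  show ?case
    using Suc.prems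
  proof (induction "rank j" arbitrary: j rule: less_induct)
    case less
    then obtain i where j: "j = Suc i"
      by (cases j) (simp_all add: A_def)
    define b a where "b = B j + t" and "a = A j - Suc t"
    have a: "A j - t = Suc a" using less.prems by (simp add: a_def)
    have left: "F i (if s i then t else Suc t) = of_int (lam b a) \<and> lam b a > 0"
    proof (cases "s i")
      case True
      then have "A j = Suc (A i)" "B j = B i" by (simp_all add: j A_def B_def)
      then show ?thesis
        using earlier[of i] less.prems True by (simp add: b_def a_def)
    next
      case False
      then have "A j = A i" "B j = Suc (B i)" by (simp_all add: j A_def B_def)
      moreover have "rank i < rank j" using rank[of i] False j by simp
      ultimately show ?thesis
        using less.hyps[of i] less.prems False by (simp add: b_def a_def)
    qed
    have right: "F (Suc j) (if s j then Suc t else t) = of_int (lam (Suc b) (Suc a)) \<and>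
        lam (Suc b) (Suc a) > 0"
    proof (cases "s j")
      case True
      then have "A (Suc j) = Suc (A j)" "B (Suc j) = B j" by (simp_all add: A_def B_def)
      moreover have "rank (Suc j) < rank j" using rank[of j] True by simp
      ultimately show ?thesis
        using less.hyps[of "Suc j"] less.prems True a by (simp add: b_def)
    next
      case False
      then have "A (Suc j) = A j" "B (Suc j) = Suc (B j)" by (simp_all add: A_def B_def)
      then show ?thesis
        using earlier[of "Suc j"] less.prems False a by (simp add: b_def)
    qed
    have now: "F j t = of_int (lam b (Suc a)) \<and> lam b (Suc a) > 0"
      using earlier[of j] less.prems a by (simp add: b_def)
    have prod: "lam b (Suc a) * lam (Suc b) a = 1 + lam b a * lam (Suc b) (Suc a)"
      by (rule Ptolemy)
    have "lam b a * lam (Suc b) (Suc a) > 0"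
      using left right by simp
    with prod have "lam b (Suc a) * lam (Suc b) a > 0"
      by linarith
    then have pos: "lam (Suc b) a > 0"
      using now by (simp add: zero_less_mult_iff)
    have "F j (Suc t) =
        (1 + of_int (lam b a) * of_int (lam (Suc b) (Suc a))) / of_int (lam b (Suc a))"
      using F_Suc[of i t] left right now unfolding j by simp
    also have "\<dots> = of_int (lam b (Suc a) * lam (Suc b) a) / of_int (lam b (Suc a))"
      unfolding prod by simp
    also have "\<dots> = of_int (lam (Suc b) a)"
      using now by simp
    finally show ?case
      using pos by (simp add: b_def a_def)
  qed
qed

text \<open>
  Both ends of the arc move during \<open>m = r q = s p\<close> time steps by whole turns around the
  annulus, in opposite directions, so that only the total number of turns matters.
\<close>

lemma lambda_recurrence:
  fixes lam :: "nat \<Rightarrow> nat \<Rightarrow> int"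
  assumes deck: "\<And>b a. lam (b + q) (a + p) = lam b a"
    and wind: "\<And>b a. lam (b + 2 * q) a = x * lam (b + q) a - lam b a"
  shows "lam (b + 2 * (r * q)) a + lam b (a + 2 * (s * p)) =
      bracelet x (r + s) * lam (b + r * q) (a + s * p)"
proof -
  have deck_iter: "lam (b + N * q) (a + N * p) = lam b a" for N b a
  proof (induction N)
    case (Suc N)
    then show ?case
      using deck[of "b + N * q" "a + N * p"] by (simp add: add_ac)
  qed simp
  define g where "g = (\<lambda>j. lam (b + j * q) (a + 2 * (s * p)))"
  have "g (j + 2) = x * g (j + 1) - g j" for j
    using wind[of "b + j * q" "a + 2 * (s * p)"] by (simp add: g_def add_ac distrib_right mult_2)
  then have "g ((r + s) + (r + s)) + g ((r + s) - (r + s)) = bracelet x (r + s) * g (r + s)"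
    by (rule bracelet_recurrence) simp
  moreover have "g ((r + s) + (r + s)) = lam (b + 2 * (r * q)) a"
    using deck_iter[of "b + 2 * (r * q)" "2 * s" a]
    by (simp add: g_def add_ac distrib_right mult_2 mult.assoc)
  moreover have "g (r + s) = lam (b + r * q) (a + s * p)"
    using deck_iter[of "b + r * q" s "a + s * p"]
    by (simp add: g_def add_ac distrib_right mult_2)
  ultimately show ?thesis
    by (simp add: g_def)
qed

section \<open>Traversals of a cycle quiver\<close>

lemma incident_arcs:
  assumes cyc: "cycle_traversal Q vs es" and n: "length vs = n" "n \<ge> 2"
  shows "{a \<in> arcs Q. tail Q a = vs ! (Suc j mod n) \<or> head Q a = vs ! (Suc j mod n)} =
      {es ! (j mod n), es ! (Suc j mod n)}" (is "?L = ?R")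
    and "es ! (j mod n) \<noteq> es ! (Suc j mod n)"
proof -
  have c: "distinct vs" "distinct es" "set es = arcs Q" "length es = n"
    "\<And>i. i < n \<Longrightarrow> {tail Q (es ! i), head Q (es ! i)} = {vs ! i, vs ! (Suc i mod n)}"
    using cyc n unfolding cycle_traversal_def by auto
  have lt: "k mod n < n" for k using n by simp
  have mod_eq: "j mod n = i" if "i < n" "Suc i mod n = Suc j mod n" for i
    using that n by (auto simp: mod_Suc split: if_splits)
  have "j mod n \<noteq> Suc j mod n"
    using n(2) by (simp add: mod_Suc)
  then show "es ! (j mod n) \<noteq> es ! (Suc j mod n)"
    using c lt by (simp add: nth_eq_iff_index_eq)
  show "?L = ?R"
  proof
    show "?L \<subseteq> ?R"
    proof
      fix a assume a: "a \<in> ?L"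
      then obtain i where i: "i < n" "a = es ! i"
        using c by (metis (no_types, lifting) in_set_conv_nth mem_Collect_eq)
      then have "vs ! (Suc j mod n) = vs ! i \<or> vs ! (Suc j mod n) = vs ! (Suc i mod n)"
        using a i c(5)[OF i(1)] by (auto simp: doubleton_eq_iff)
      then have "Suc j mod n = i \<or> Suc j mod n = Suc i mod n"
        using c(1) n lt i by (simp add: nth_eq_iff_index_eq)
      then show "a \<in> ?R" using i mod_eq[of i] by auto
    qed
    have "es ! (k mod n) \<in> arcs Q" for k
      using c lt[of k] nth_mem by metis
    moreover have "vs ! (Suc j mod n) \<in> {tail Q (es ! (j mod n)), head Q (es ! (j mod n))}"
      using c(5)[of "j mod n"] lt by (simp add: mod_Suc_eq)
    moreover have
      "vs ! (Suc j mod n) \<in> {tail Q (es ! (Suc j mod n)), head Q (es ! (Suc j mod n))}"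
      using c(5)[of "Suc j mod n"] lt by simp
    ultimately show "?R \<subseteq> ?L" by auto
  qed
qed

lemma forward_arrow_iff:
  assumes cyc: "cycle_traversal Q vs es" and n: "length vs = n" "n \<ge> 2"
    and loopfree: "\<And>a. a \<in> arcs Q \<Longrightarrow> tail Q a \<noteq> head Q a"
  shows "forward_arrow Q vs es (j mod n) \<longleftrightarrow> head Q (es ! (j mod n)) = vs ! (Suc j mod n)"
    and "forward_arrow Q vs es (j mod n) \<longleftrightarrow> tail Q (es ! (j mod n)) = vs ! (j mod n)"
    and "forward_arrow Q vs es (j mod n) \<longleftrightarrow> head Q (es ! (j mod n)) \<noteq> vs ! (j mod n)"
    and "forward_arrow Q vs es (j mod n) \<longleftrightarrow> tail Q (es ! (j mod n)) \<noteq> vs ! (Suc j mod n)"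
proof -
  have lt: "j mod n < n" using n by simp
  have "{tail Q (es ! (j mod n)), head Q (es ! (j mod n))} = {vs ! (j mod n), vs ! (Suc j mod n)}"
    using cyc n lt unfolding cycle_traversal_def by (simp add: mod_Suc_eq)
  moreover have "es ! (j mod n) \<in> arcs Q"
    using cyc n lt unfolding cycle_traversal_def by (metis nth_mem)
  then have "tail Q (es ! (j mod n)) \<noteq> head Q (es ! (j mod n))"
    by (rule loopfree)
  moreover have "forward_arrow Q vs es (j mod n) \<longleftrightarrow>
      tail Q (es ! (j mod n)) = vs ! (j mod n) \<and> head Q (es ! (j mod n)) = vs ! (Suc j mod n)"
    using n unfolding forward_arrow_def by (simp add: mod_Suc_eq)
  ultimately show "forward_arrow Q vs es (j mod n) \<longleftrightarrow> head Q (es ! (j mod n)) = vs ! (Suc j mod n)"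
    "forward_arrow Q vs es (j mod n) \<longleftrightarrow> tail Q (es ! (j mod n)) = vs ! (j mod n)"
    "forward_arrow Q vs es (j mod n) \<longleftrightarrow> head Q (es ! (j mod n)) \<noteq> vs ! (j mod n)"
    "forward_arrow Q vs es (j mod n) \<longleftrightarrow> tail Q (es ! (j mod n)) \<noteq> vs ! (Suc j mod n)"
    by (metis doubleton_eq_iff)+
qed

definition forward_arcs :: "('a, 'b) pre_digraph \<Rightarrow> 'a list \<Rightarrow> 'b list \<Rightarrow> 'b set" where
  "forward_arcs Q vs es = {es ! i |i. i < length es \<and> forward_arrow Q vs es i}"

lemma nth_mem_forward_arcs_iff:
  assumes "cycle_traversal Q vs es" "i < length es"
  shows "es ! i \<in> forward_arcs Q vs es \<longleftrightarrow> forward_arrow Q vs es i"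
  using assms unfolding cycle_traversal_def forward_arcs_def
  by (auto simp: nth_eq_iff_index_eq)

lemma card_forward_arcs:
  assumes "cycle_traversal Q vs es"
  shows "card (forward_arcs Q vs es) = card {i. i < length es \<and> forward_arrow Q vs es i}"
proof -
  have "forward_arcs Q vs es = (!) es ` {i. i < length es \<and> forward_arrow Q vs es i}"
    unfolding forward_arcs_def by auto
  moreover have "inj_on ((!) es) {i. i < length es \<and> forward_arrow Q vs es i}"
    using assms unfolding cycle_traversal_def inj_on_def by (auto simp: nth_eq_iff_index_eq)
  ultimately show ?thesis by (simp add: card_image)
qed

text \<open>
  At a vertex a traversal enters through one of the two arcs and leaves through the other. So the two
  arcs agree in being traversed forwards exactly if one of them ends and the other starts there,
  a condition that does not mention the traversal.
\<close>

lemma forward_arcs_at_vertex: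
  assumes cyc: "cycle_traversal Q vs es" and n: "length vs = n" "n \<ge> 2"
    and loopfree: "\<And>a. a \<in> arcs Q \<Longrightarrow> tail Q a \<noteq> head Q a"
    and v: "v \<in> verts Q"
    and xy: "{a \<in> arcs Q. tail Q a = v \<or> head Q a = v} = {x, y}" "x \<noteq> y"
  shows "(x \<in> forward_arcs Q vs es \<longleftrightarrow> y \<in> forward_arcs Q vs es) \<longleftrightarrow>
      (head Q x = v \<longleftrightarrow> head Q y \<noteq> v)"
proof -
  have len: "length es = n" using cyc n unfolding cycle_traversal_def by simp
  obtain k where k: "k < n" "v = vs ! k"
    using cyc v n unfolding cycle_traversal_def by (metis in_set_conv_nth)
  \<comment> \<open>The predecessor of \<open>k\<close> on the cycle, shifted by \<open>n\<close> to make it a natural number.\<close>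
  define j where "j = k + n - 1"
  have "Suc j mod n = k" using k n by (simp add: j_def)
  with k have vj: "v = vs ! (Suc j mod n)" by simp
  have e: "{x, y} = {es ! (j mod n), es ! (Suc j mod n)}"
    using incident_arcs(1)[OF cyc n, of j] xy vj by simp
  have lt: "i mod n < length es" for i using n len by simp
  have "(es ! (j mod n) \<in> forward_arcs Q vs es \<longleftrightarrow>
         es ! (Suc j mod n) \<in> forward_arcs Q vs es) \<longleftrightarrow>
      (head Q (es ! (j mod n)) = v \<longleftrightarrow> head Q (es ! (Suc j mod n)) \<noteq> v)"
    using forward_arrow_iff(1)[OF cyc n loopfree, of j]
      forward_arrow_iff(3)[OF cyc n loopfree, of "Suc j"] vj
    by (simp add: nth_mem_forward_arcs_iff[OF cyc lt])
  with e xy(2) show ?thesis by (auto simp: doubleton_eq_iff)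
qed

lemma forward_count_unique:
  assumes cyc: "cycle_traversal Q vs es" and cyc': "cycle_traversal Q vs' es'"
    and n: "length vs = n" "n \<ge> 2"
    and loopfree: "\<And>a. a \<in> arcs Q \<Longrightarrow> tail Q a \<noteq> head Q a"
  defines "c \<equiv> card {i. i < length es \<and> forward_arrow Q vs es i}"
    and "c' \<equiv> card {i. i < length es' \<and> forward_arrow Q vs' es' i}"
  shows "c' = c \<or> c' = n - c"
proof -
  let ?S = "forward_arcs Q vs es" and ?S' = "forward_arcs Q vs' es'"
  have n': "length vs' = n"
    using cyc cyc' n unfolding cycle_traversal_def by (metis distinct_card)
  have es: "set es = arcs Q" "length es = n" "distinct es"
    using cyc n unfolding cycle_traversal_def by auto
  have "(es ! (j mod n) \<in> ?S \<longleftrightarrow> es ! (j mod n) \<in> ?S') \<longleftrightarrow> (es ! 0 \<in> ?S \<longleftrightarrow> es ! 0 \<in> ?S')" for j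
  proof (induction j)
    case (Suc j)
    let ?v = "vs ! (Suc j mod n)"
    have "?v \<in> verts Q"
      using cyc n unfolding cycle_traversal_def
      by (metis mod_less_divisor nth_mem pos2 order_less_le_trans)
    note at = forward_arcs_at_vertex[OF _ _ n(2) loopfree this incident_arcs[OF cyc n]]
    show ?case
      using at[OF cyc n(1)] at[OF cyc' n'] Suc by blast
  qed simp
  then have all: "(a \<in> ?S \<longleftrightarrow> a \<in> ?S') \<longleftrightarrow> (es ! 0 \<in> ?S \<longleftrightarrow> es ! 0 \<in> ?S')" if "a \<in> arcs Q" for a
    using that es by (metis in_set_conv_nth mod_less)
  have sub: "?S \<subseteq> arcs Q" "?S' \<subseteq> arcs Q"
    using cyc cyc' unfolding cycle_traversal_def forward_arcs_def by (auto simp flip: set_conv_nth)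
  have "?S' = ?S \<or> ?S' = arcs Q - ?S"
    using all sub by blast
  moreover have "card (arcs Q) = n" "finite (arcs Q)"
    using es by (metis distinct_card, metis List.finite_set)
  then have "card (arcs Q - ?S) = n - card ?S"
    using sub by (simp add: card_Diff_subset finite_subset)
  ultimately show ?thesis
    unfolding c_def c'_def card_forward_arcs[OF cyc, symmetric] card_forward_arcs[OF cyc', symmetric]
    by auto
qed

lemma vertex_products:
  fixes g h :: "'a \<Rightarrow> rat"
  assumes cyc: "cycle_traversal Q vs es" and n: "length vs = n" "n \<ge> 2"
    and loopfree: "\<And>a. a \<in> arcs Q \<Longrightarrow> tail Q a \<noteq> head Q a"
  defines "v \<equiv> \<lambda>j. vs ! (j mod n)" and "s \<equiv> \<lambda>j. forward_arrow Q vs es (j mod n)"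
  shows "(\<Prod>a\<in>in_arcs Q (v (Suc j)). g (tail Q a)) * (\<Prod>a\<in>out_arcs Q (v (Suc j)). h (head Q a)) =
      (if s j then g (v j) else h (v j)) *
      (if s (Suc j) then h (v (Suc (Suc j))) else g (v (Suc (Suc j))))"
proof -
  let ?w = "v (Suc j)"
  let ?x = "es ! (j mod n)" and ?y = "es ! (Suc j mod n)"
  let ?F = "\<lambda>a. if head Q a = ?w then g (tail Q a) else h (head Q a)"
  have inc: "{a \<in> arcs Q. tail Q a = ?w \<or> head Q a = ?w} = {?x, ?y}" and ne: "?x \<noteq> ?y"
    using incident_arcs[OF cyc n, of j] by (simp_all add: v_def)
  have un: "in_arcs Q ?w \<union> out_arcs Q ?w = {?x, ?y}"
    unfolding inc[symmetric] by (auto simp: in_arcs_def out_arcs_def)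
  have disj: "in_arcs Q ?w \<inter> out_arcs Q ?w = {}"
    using loopfree by (fastforce simp: in_arcs_def out_arcs_def)
  have fin: "finite (in_arcs Q ?w)" "finite (out_arcs Q ?w)"
    using un by (metis finite.emptyI finite_Un finite_insert)+
  have "(\<Prod>a\<in>in_arcs Q ?w. g (tail Q a)) * (\<Prod>a\<in>out_arcs Q ?w. h (head Q a)) =
      (\<Prod>a\<in>in_arcs Q ?w. ?F a) * (\<Prod>a\<in>out_arcs Q ?w. ?F a)"
    by (intro arg_cong2[of _ _ _ _ "(*)"] prod.cong)
       (use loopfree in \<open>fastforce simp: in_arcs_def out_arcs_def\<close>)+
  also have "\<dots> = (\<Prod>a\<in>{?x, ?y}. ?F a)"
    using prod.union_disjoint[OF fin disj, of ?F] un by simp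
  also have "\<dots> = ?F ?x * ?F ?y"
    using ne by simp
  also have "?F ?x = (if s j then g (v j) else h (v j))"
  proof -
    have "{tail Q ?x, head Q ?x} = {v j, ?w}"
      using cyc n unfolding cycle_traversal_def v_def by (simp add: mod_Suc_eq)
    then show ?thesis
      using forward_arrow_iff[OF cyc n loopfree, of j]
      by (auto simp: s_def v_def doubleton_eq_iff)
  qed
  also have "?F ?y = (if s (Suc j) then h (v (Suc (Suc j))) else g (v (Suc (Suc j))))"
  proof -
    have "{tail Q ?y, head Q ?y} = {?w, v (Suc (Suc j))}"
      using cyc n unfolding cycle_traversal_def v_def by (simp add: mod_Suc_eq)
    then show ?thesis
      using forward_arrow_iff[OF cyc n loopfree, of "Suc j"]
      by (auto simp: s_def v_def doubleton_eq_iff)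
  qed
  finally show ?thesis .
qed

section \<open>The recurrence\<close>

theorem theorem3p3:
  fixes p q :: nat
    and Q :: "(nat, 'b) pre_digraph"
    and vs :: "nat list" and es :: "'b list"
    and f :: "nat \<Rightarrow> nat \<Rightarrow> rat"
    and i t m :: nat
  assumes "p \<ge> 1" and "q \<ge> 1"
    and "affine_A_quiver p q Q"
    and "verts Q = {1..p + q}"
    and "\<And>a. a \<in> arcs Q \<Longrightarrow> tail Q a > head Q a"
    and "cycle_traversal Q vs es"
    and "\<And>i. i \<in> verts Q \<Longrightarrow> f i 0 = 1"
    and "\<And>i t. i \<in> verts Q \<Longrightarrow>
           f i (t + 1) =
             (1 + (\<Prod>a\<in>in_arcs Q i. f (tail Q a) t) * (\<Prod>a\<in>out_arcs Q i. f (head Q a) (t + 1)))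
               / f i t"
    and "m = lcm p q"
    and "i \<in> verts Q"
    and "t \<ge> m"
  shows "f i (t + m) = of_int (C_const p q Q vs es) * f i t - f i (t - m)"
proof -
  define n where "n = p + q"
  define s where "s = (\<lambda>j. forward_arrow Q vs es (j mod n))"
  define v where "v = (\<lambda>j. vs ! (j mod n))"
  let ?A = "count_before s" and ?B = "count_before (\<lambda>j. \<not> s j)"
  note cyc = \<open>cycle_traversal Q vs es\<close>
  have loopfree: "tail Q a \<noteq> head Q a" if "a \<in> arcs Q" for a
    using assms(5)[OF that] by simp
  have n2: "n \<ge> 2" using assms(1,2) by (simp add: n_def)
  have len: "length vs = n" "length es = n"
    using cyc assms(4) unfolding cycle_traversal_def
    by (metis card_atLeastAtMost diff_Suc_1 distinct_card n_def)+
  have per: "s (j + n) = s j" for j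
    by (simp add: s_def)
  have An: "?A n = card {i. i < length es \<and> forward_arrow Q vs es i}"
    unfolding count_before_def len(2) s_def by (rule arg_cong[of _ _ card]) auto
  have AB: "?A n + ?B n = n"
  proof -
    have "?A j + ?B j = j" for j by (induction j) auto
    then show ?thesis .
  qed
  obtain vs' es' where cyc': "cycle_traversal Q vs' es'"
    and p: "card {i. i < length es' \<and> forward_arrow Q vs' es' i} = p"
    using \<open>affine_A_quiver p q Q\<close> unfolding affine_A_quiver_def by blast
  have "p = ?A n \<or> p = n - ?A n"
    using forward_count_unique[OF cyc cyc' len(1) n2 loopfree] p An by simp
  then have pq: "?A n = p \<and> ?B n = q \<or> ?A n = q \<and> ?B n = p"
    using AB by (auto simp: n_def)
  then have pos: "?A n \<ge> 1" "?B n \<ge> 1"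
    using assms(1,2) by auto

  obtain lam where lam:
    "\<And>j. lam (?B j) (?A j) = 1"
    "\<And>b a. lam b (Suc a) * lam (Suc b) a = 1 + lam b a * lam (Suc b) (Suc a)"
    "\<And>b a. lam (b + ?B n) (a + ?A n) = lam b a"
    "\<And>b a. lam (b + 2 * ?B n) a = trace (frame s n) * lam (b + ?B n) a - lam b a"
    using lambda_lengths_exist[of s n, OF per pos] by metis
  have v_verts: "v j \<in> verts Q" for j
    using cyc len n2 unfolding cycle_traversal_def v_def
    by (metis mod_less_divisor nth_mem pos2 order_less_le_trans)
  have f_eq: "f (v j) t = of_int (lam (?B j + t) (?A j - t))" if "t \<le> ?A j" for j t
  proof (rule conjunct1[OF recursion_eq_lambda[where F = "\<lambda>j. f (v j)" and rank = v]])
    show "f (v j) 0 = 1" for j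
      by (rule assms(7)[OF v_verts])
    show "f (v (Suc j)) (Suc t) =
        (1 + f (v j) (if s j then t else Suc t) *
             f (v (Suc (Suc j))) (if s (Suc j) then Suc t else t)) / f (v (Suc j)) t" for j t
      using assms(8)[OF v_verts, of "Suc j" t]
        vertex_products[OF cyc len(1) n2 loopfree, of "\<lambda>i. f i t" j "\<lambda>i. f i (Suc t)"]
      by (simp add: v_def s_def if_distrib)
    show "if s j then v (Suc j) < v j else v j < v (Suc j)" for j
    proof -
      have lt: "j mod n < n" using n2 by simp
      then have "es ! (j mod n) \<in> arcs Q"
        using cyc len unfolding cycle_traversal_def by (metis nth_mem)
      then have "head Q (es ! (j mod n)) < tail Q (es ! (j mod n))"
        by (rule assms(5))
      moreover have "{tail Q (es ! (j mod n)), head Q (es ! (j mod n))} = {v j, v (Suc j)}"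
        using cyc len lt unfolding cycle_traversal_def v_def by (simp add: mod_Suc_eq)
      ultimately show ?thesis
        using forward_arrow_iff[OF cyc len(1) n2 loopfree, of j]
        by (auto simp: s_def v_def doubleton_eq_iff)
    qed
  qed (use lam that in auto)

  obtain k where k: "k < n" "i = vs ! k"
    using cyc assms(10) len unfolding cycle_traversal_def by (metis in_set_conv_nth)
  \<comment> \<open>Another lift of the vertex, so far along the strip that the index of its \<open>u\<close>-end stays
      non-negative up to time \<open>t + m\<close>.\<close>
  define j where "j = k + (t + m) * n"
  have vj: "v j = i" using k by (simp add: v_def j_def)
  have big: "t + m \<le> ?A j"
    using count_before_add_multiple[of s n, OF per, of k "t + m"] pos(1)
    by (simp add: j_def trans_le_add2)
  define r where "r = m div ?B n"
  define r' where "r' = m div ?A n"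
  have m: "m = r * ?B n" "m = r' * ?A n"
    using pq assms(9) by (auto simp: r_def r'_def)
  have turns: "r + r' = (p + q) div gcd p q"
  proof -
    have "lcm p q = p * (q div gcd p q)" "lcm p q = q * (p div gcd p q)"
      by (simp_all add: lcm_nat_def div_mult_swap mult.commute)
    then have "lcm p q div p = q div gcd p q" "lcm p q div q = p div gcd p q"
      using assms(1,2) by (metis nonzero_mult_div_cancel_left not_one_le_zero)+
    then have "r + r' = p div gcd p q + q div gcd p q"
      using pq assms(9) by (auto simp: r_def r'_def)
    then show ?thesis by (simp add: div_plus_div_distrib_dvd_left)
  qed
  have trace: "trace (frame s n) = equator_value Q vs es"
  proof -
    have "map (\<lambda>i. step_matrix (s i)) [0..<n] =
        map (\<lambda>i. step_matrix (forward_arrow Q vs es i)) [0..<n]"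
      by (simp add: s_def)
    then show ?thesis
      unfolding equator_value_def frame_eq_foldr len(2) by (rule arg_cong)
  qed
  define b a where "b = ?B j + (t - m)" and "a = ?A j - (t + m)"
  have "lam (b + 2 * m) a + lam b (a + 2 * m) =
      C_const p q Q vs es * lam (b + m) (a + m)"
    using lambda_recurrence[of lam "?B n" "?A n" _ b r a r', OF lam(3,4)] m turns trace
    by (simp add: C_const_def)
  moreover have "f i (t + m) = of_int (lam (b + 2 * m) a)"
    using f_eq[OF big] vj \<open>t \<ge> m\<close> by (simp add: b_def a_def mult_2)
  moreover have "f i t = of_int (lam (b + m) (a + m))"
    using f_eq[of t j] big vj \<open>t \<ge> m\<close> by (simp add: b_def a_def)
  moreover have "f i (t - m) = of_int (lam b (a + 2 * m))"
    using f_eq[of "t - m" j] big vj \<open>t \<ge> m\<close> by (simp add: b_def a_def mult_2)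
  ultimately show ?thesis
    by (metis add_diff_cancel_right' of_int_add of_int_mult)
qed

end
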